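(* Let $\Omega\subset\mathbb{R}^N$ be a bounded Lipschitz domain. Assume that symmetric and log-Hölder continuous functions $p:\overline{\Omega}^2\to\mathbb{R}$ and $s:\overline{\Omega}^2\to\mathbb{R}$ satisfy $0<s^{-}\leq s^{+}<1$ and $1<p^{-}\leq p^{+}<N/s^{+}$. In addition, assume that any point of the diagonal set $\{(x,y)\in\overline{\Omega}^2\mid x=y\}$ is a (not necessarily strict) local minimum point of $s(x,y)$ and of $p(x,y)$ (as functions on $\overline{\Omega}^2$). Let $q:\overline{\Omega}\to\mathbb{R}$ be a continuous function such that $p^{+}\leq q^{-}\leq q(x)\leq p_s^*(x)$ for all $x$. Then the continuous embedding $W^{s(x,y),p(x,y)}(\Omega)\hookrightarrow L^{q(x)}(\Omega)$ holds.
   Context: Notation: for any variable exponent $\Phi$, $\Phi^{+}=\sup\Phi$ and $\Phi^{-}=\inf\Phi$ over its domain of definition. A domain is a connected open set. A function $f$ on a bounded set is log-Hölder continuous if it is continuous and there is $C>0$ with $|f(x)-f(y)|\log\frac{1}{|x-y|}\leq C$ for all $x\neq y$ in the set. A function on $\overline\Omega\times\overline\Omega$ is symmetric if $f(x,y)=f(y,x)$. Critical Sobolev exponent: $p_s^*(x)=\dfrac{Np(x,x)}{N-p(x,x)s(x,x)}$. Nakano space: $L^{q(x)}(\Omega)$ is the set of measurable $u:\Omega\to\mathbb{R}$ with $\int_\Omega|u(x)|^{q(x)}dx<\infty$, with Luxemburg norm $\|u\|_{q(x)}=\inf\{\lambda>0\mid\int_\Omega|u(x)/\lambda|^{q(x)}dx\leq1\}$.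 Variable-order Sobolev space: define the modular \[ \varrho(u)=\int_\Omega\int_\Omega\frac{|u(x)-u(y)|^{p(x,y)}}{|x-y|^{N+s(x,y)p(x,y)}}dxdy+\int_\Omega|u|^{p(x,x)}dx \] and the norm $\|u\|=\inf\{\lambda>0\mid\varrho(u/\lambda)<1\}$ (with $\inf\emptyset=\infty$). Then $W^{s(x,y),p(x,y)}(\Omega)=\{u\in L^{p(x,x)}(\Omega)\mid\|u\|<\infty\}$ with norm $\|\cdot\|$. *)

theory Defs
  imports "HOL-Analysis.Analysis"
begin

text \<open>In the coordinates \<open>x = x' + t e\<close>, with \<open>x'\<close> orthogonal to the unit vector \<open>e\<close>,
  the set is locally the part of the space lying strictly above the graph of a Lipschitz function
  on the hyperplane orthogonal to \<open>e\<close>. In dimension 1 that hyperplane is \<open>{0}\<close>.\<close>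

definition lipschitz_boundary :: "'a::euclidean_space set \<Rightarrow> bool" where
  "lipschitz_boundary \<Omega> \<longleftrightarrow>
     (\<forall>x0\<in>frontier \<Omega>. \<exists>e r g L. norm e = 1 \<and> r > 0 \<and> L-lipschitz_on {y. y \<bullet> e = 0} g \<and>
        \<Omega> \<inter> ball x0 r = {x \<in> ball x0 r. g (x - (x \<bullet> e) *\<^sub>R e) < x \<bullet> e})"

definition bounded_lipschitz_domain :: "'a::euclidean_space set \<Rightarrow> bool" where
  "bounded_lipschitz_domain \<Omega> \<longleftrightarrow>
     open \<Omega> \<and> connected \<Omega> \<and> bounded \<Omega> \<and> lipschitz_boundary \<Omega>"

definition log_holder_on :: "'a::metric_space set \<Rightarrow> ('a \<Rightarrow> real) \<Rightarrow> bool" where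
  "log_holder_on S f \<longleftrightarrow> continuous_on S f \<and>
     (\<exists>C>0. \<forall>x\<in>S. \<forall>y\<in>S. x \<noteq> y \<longrightarrow> \<bar>f x - f y\<bar> * ln (1 / dist x y) \<le> C)"

definition symmetric_on :: "'a set \<Rightarrow> ('a \<times> 'a \<Rightarrow> 'b) \<Rightarrow> bool" where
  "symmetric_on S f \<longleftrightarrow> (\<forall>x\<in>S. \<forall>y\<in>S. f (x, y) = f (y, x))"

definition local_min_point :: "'a::topological_space set \<Rightarrow> ('a \<Rightarrow> real) \<Rightarrow> 'a \<Rightarrow> bool" where
  "local_min_point S f a \<longleftrightarrow> a \<in> S \<and> (\<forall>\<^sub>F z in at a within S. f a \<le> f z)"

definition critical_exponent ::
    "('a::euclidean_space \<times> 'a \<Rightarrow> real) \<Rightarrow> ('a \<times> 'a \<Rightarrow> real) \<Rightarrow> 'a \<Rightarrow> real" where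
  "critical_exponent s p x =
     real DIM('a) * p (x, x) / (real DIM('a) - p (x, x) * s (x, x))"

text \<open>The function spaces consist of functions rather than of classes modulo equality almost
  everywhere, and only the values on \<open>\<Omega>\<close> matter. Both norms take values in
  \<^typ>\<open>ennreal\<close>, where the infimum of the empty set is \<open>\<infinity>\<close>.\<close>

definition nakano_modular ::
    "'a::euclidean_space set \<Rightarrow> ('a \<Rightarrow> real) \<Rightarrow> ('a \<Rightarrow> real) \<Rightarrow> ennreal" where
  "nakano_modular \<Omega> q u = (\<integral>\<^sup>+x. ennreal (\<bar>u x\<bar> powr q x) \<partial>lebesgue_on \<Omega>)"

definition nakano_space ::
    "'a::euclidean_space set \<Rightarrow> ('a \<Rightarrow> real) \<Rightarrow> ('a \<Rightarrow> real) set" where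
  "nakano_space \<Omega> q =
     {u. u \<in> borel_measurable (lebesgue_on \<Omega>) \<and> nakano_modular \<Omega> q u < \<infinity>}"

definition nakano_norm ::
    "'a::euclidean_space set \<Rightarrow> ('a \<Rightarrow> real) \<Rightarrow> ('a \<Rightarrow> real) \<Rightarrow> ennreal" where
  "nakano_norm \<Omega> q u =
     (INF t\<in>{t::real. t > 0 \<and> nakano_modular \<Omega> q (\<lambda>x. u x / t) \<le> 1}. ennreal t)"

text \<open>On the diagonal the quotient below is a division by zero, hence 0 in HOL; the
  diagonal does not contribute to the integral.\<close>

definition sobolev_modular ::
    "'a::euclidean_space set \<Rightarrow> ('a \<times> 'a \<Rightarrow> real) \<Rightarrow> ('a \<times> 'a \<Rightarrow> real) \<Rightarrow> ('a \<Rightarrow> real) \<Rightarrow> ennreal"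
  where
  "sobolev_modular \<Omega> s p u =
     (\<integral>\<^sup>+y. (\<integral>\<^sup>+x. ennreal (\<bar>u x - u y\<bar> powr p (x, y) /
         norm (x - y) powr (real DIM('a) + s (x, y) * p (x, y))) \<partial>lebesgue_on \<Omega>) \<partial>lebesgue_on \<Omega>)
     + (\<integral>\<^sup>+x. ennreal (\<bar>u x\<bar> powr p (x, x)) \<partial>lebesgue_on \<Omega>)"

definition sobolev_norm ::
    "'a::euclidean_space set \<Rightarrow> ('a \<times> 'a \<Rightarrow> real) \<Rightarrow> ('a \<times> 'a \<Rightarrow> real) \<Rightarrow> ('a \<Rightarrow> real) \<Rightarrow> ennreal"
  where
  "sobolev_norm \<Omega> s p u =
     (INF t\<in>{t::real. t > 0 \<and> sobolev_modular \<Omega> s p (\<lambda>x. u x / t) < 1}. ennreal t)"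

definition sobolev_space ::
    "'a::euclidean_space set \<Rightarrow> ('a \<times> 'a \<Rightarrow> real) \<Rightarrow> ('a \<times> 'a \<Rightarrow> real) \<Rightarrow> ('a \<Rightarrow> real) set"
  where
  "sobolev_space \<Omega> s p =
     {u \<in> nakano_space \<Omega> (\<lambda>x. p (x, x)). sobolev_norm \<Omega> s p u < \<infinity>}"

definition continuous_embedding ::
    "'u set \<Rightarrow> ('u \<Rightarrow> ennreal) \<Rightarrow> 'u set \<Rightarrow> ('u \<Rightarrow> ennreal) \<Rightarrow> bool" where
  "continuous_embedding X norm_X Y norm_Y \<longleftrightarrow>
     X \<subseteq> Y \<and> (\<exists>C::real. C > 0 \<and> (\<forall>u\<in>X. norm_Y u \<le> ennreal C * norm_X u))"

end

theory Submission
  imports Defs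
begin

text \<open>
  The hypothesis on the diagonal is much stronger than it looks. If every point \<open>(x, x)\<close> is a local
  minimum of \<open>p\<close>, then every point is a local minimum of the continuous function \<open>x \<mapsto> p (x, x)\<close>
  on the connected set \<open>closure \<Omega>\<close>, so its superlevel sets are both open and closed, and it is a
  constant \<open>p0\<close>. Likewise \<open>s (x, x)\<close> is a constant \<open>s0\<close>. By compactness \<open>p \<ge> p0\<close> and \<open>s \<ge> s0\<close> in
  a uniform neighbourhood of the diagonal. The critical exponent is therefore a constant
  \<open>P = N p0 / (N - s0 p0)\<close>, and since \<open>\<bar>u\<bar> powr q x \<le> 1 + \<bar>u\<bar> powr P\<close> on a set of finite measure, it
  suffices to bound \<open>\<integral> \<bar>u\<bar>\<^sup>P\<close> by a constant whenever the Sobolev modular of \<open>u\<close> is below 1.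

  For this bound, truncate \<open>u\<close> to a bounded \<open>v \<ge> 0\<close>, so that \<open>T = \<integral> v\<^sup>P\<close> is finite beforehand, and let
  \<open>G y\<close> be the inner integral of the modular. Fix \<open>y\<close> with a large value \<open>v y\<close>. A Lipschitz domain
  has the measure density property \<open>c r\<^sup>N \<le> \<bar>\<Omega> \<inter> B(y, r)\<bar>\<close> for small \<open>r\<close>. Choose \<open>r\<close> so that the
  Chebyshev bound for the set \<open>{v > v y / 2}\<close> is at most \<open>c r\<^sup>N / 2\<close>. On the rest of
  the ball, \<open>\<bar>v x - v y\<bar> \<ge> v y / 2 \<ge> 1\<close> and \<open>\<bar>x - y\<bar> \<le> r \<le> 1\<close>. There the exponents may be
  replaced by the smaller constants \<open>p0\<close> and \<open>s0\<close>, which only lowers the kernel. This gives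
  \<open>G y \<ge> C (v y) powr p0 * r powr (- s0 p0)\<close>. With the optimal \<open>r\<close> this reads
  \<open>(v y)\<^sup>P \<le> C' T powr \<theta> * G y\<close> with \<open>\<theta> = s0 p0 / N < 1\<close>, and integration gives
  \<open>T \<le> \<alpha> + C' T powr \<theta>\<close>, which bounds \<open>T\<close>. Monotone convergence removes the truncation.

  The two geometric inputs are \<open>diagonal_local_min_imp_constant\<close> and
  \<open>lipschitz_domain_measure_density\<close>; the analytic heart is \<open>kernel_integral_lower_bound\<close> together
  with \<open>critical_power_integral_bound_bounded\<close>.
\<close>


section \<open>Measure density of Lipschitz domains\<close>

text \<open>A finite subcover turns a property that holds with a locally uniform radius, and that survives
  shrinking the radius, into one that holds with a single radius.\<close>

lemma compact_uniform_radius: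
  fixes K :: "'a::metric_space set"
  assumes "compact K"
    and mono: "\<And>x d e. P x e \<Longrightarrow> 0 < d \<Longrightarrow> d \<le> e \<Longrightarrow> P x d"
    and local: "\<And>a. a \<in> K \<Longrightarrow> \<exists>e>0. \<forall>x\<in>K \<inter> ball a e. P x e"
  obtains e :: real where "0 < e" "\<And>x. x \<in> K \<Longrightarrow> P x e"
proof -
  obtain e where e: "\<And>a. a \<in> K \<Longrightarrow> 0 < e a \<and> (\<forall>x\<in>K \<inter> ball a (e a). P x (e a))"
    using local by metis
  have "K \<subseteq> (\<Union>a\<in>K. ball a (e a))"
    using e by force
  then obtain D where D: "D \<subseteq> K" "finite D" "K \<subseteq> (\<Union>a\<in>D. ball a (e a))"
    using compactE_image[OF \<open>compact K\<close>, of K "\<lambda>a. ball a (e a)"] by auto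
  let ?m = "Min (insert 1 (e ` D))"
  have m: "0 < ?m" "\<And>a. a \<in> D \<Longrightarrow> ?m \<le> e a"
    using D e by (auto simp: Min_gr_iff)
  show thesis
  proof (rule that[OF m(1)])
    fix x assume "x \<in> K"
    then obtain a where a: "a \<in> D" "x \<in> ball a (e a)" using D by blast
    then have "P x (e a)" using e[of a] D \<open>x \<in> K\<close> by auto
    then show "P x ?m" using mono m a by blast
  qed
qed

text \<open>An interior corkscrew condition. Near a boundary point with chart direction \<open>e\<close>, moving from \<open>x\<close>
  by \<open>r / 2\<close> along \<open>e\<close> gains height \<open>r / 2\<close> over the graph. A perturbation \<open>w\<close> costs at
  most \<open>(L + 1) * norm w\<close> of it, hence a ball of radius \<open>r / (4 * (L + 1))\<close> stays inside. The same
  \<open>k\<close> serves as relative size of the balls and as bound for \<open>r\<close>, so that shrinking it only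
  weakens the condition and compactness applies.\<close>

lemma lipschitz_domain_interior_balls:
  fixes \<Omega> :: "'a::euclidean_space set"
  assumes "bounded_lipschitz_domain \<Omega>"
  obtains k where "0 < k"
    "\<And>x r. x \<in> \<Omega> \<Longrightarrow> 0 < r \<Longrightarrow> r \<le> k \<Longrightarrow> \<exists>z. ball z (k * r) \<subseteq> \<Omega> \<inter> ball x r"
proof -
  define P where "P x k \<longleftrightarrow> (x \<in> \<Omega> \<longrightarrow> (\<forall>r. 0 < r \<and> r \<le> k \<longrightarrow> (\<exists>z. ball z (k * r) \<subseteq> \<Omega> \<inter> ball x r)))"
    for x k
  have om: "open \<Omega>" "bounded \<Omega>" and lb: "lipschitz_boundary \<Omega>"
    using assms by (auto simp: bounded_lipschitz_domain_def)
  have "compact (closure \<Omega>)" using om by (simp add: compact_closure)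
  moreover have "P x d" if "P x e" "0 < d" "d \<le> e" for x d e
    unfolding P_def
  proof (intro impI allI)
    fix r assume "x \<in> \<Omega>" and r: "0 < r \<and> r \<le> d"
    with that obtain z where "ball z (e * r) \<subseteq> \<Omega> \<inter> ball x r"
      unfolding P_def by force
    moreover have "ball z (d * r) \<subseteq> ball z (e * r)"
      using that r by (intro subset_ball mult_right_mono) auto
    ultimately show "\<exists>z. ball z (d * r) \<subseteq> \<Omega> \<inter> ball x r" by blast
  qed
  moreover have "\<exists>e>0. \<forall>x\<in>closure \<Omega> \<inter> ball a e. P x e" if "a \<in> closure \<Omega>" for a
  proof (cases "a \<in> \<Omega>")
    case True
    with om obtain d where d: "d > 0" "ball a d \<subseteq> \<Omega>"
      using openE by blast
    let ?e = "min (d/2) 1"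
    have "P x ?e" if "x \<in> ball a ?e" for x
      unfolding P_def
    proof (intro impI allI exI[of _ x])
      fix r assume r: "0 < r \<and> r \<le> ?e"
      have "ball x (?e * r) \<subseteq> ball x r"
        using r d by (intro subset_ball) (auto intro: mult_left_le_one_le)
      moreover have "ball x r \<subseteq> ball a d"
        using r that by (auto simp: ball_subset_ball_iff dist_commute)
      ultimately show "ball x (?e * r) \<subseteq> \<Omega> \<inter> ball x r" using d by blast
    qed
    then show ?thesis using d by (intro exI[of _ ?e]) auto
  next
    case False
    then have "a \<in> frontier \<Omega>" using that om by (simp add: frontier_def interior_open)
    then obtain e R g L where e: "norm e = 1" "R > 0" "L-lipschitz_on {y. y \<bullet> e = 0} g"
      and chart: "\<Omega> \<inter> ball a R = {x \<in> ball a R. g (x - (x \<bullet> e) *\<^sub>R e) < x \<bullet> e}"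
      using lb unfolding lipschitz_boundary_def by blast
    have L: "L \<ge> 0" using e(3) by (rule lipschitz_on_nonneg)
    have ee: "e \<bullet> e = 1" using e(1) by (simp add: dot_square_norm)
    let ?k = "1 / (4 * (L + 1))"
    let ?e = "min (R/2) ?k"
    have "P x ?e" if x: "x \<in> ball a ?e" for x
      unfolding P_def
    proof (intro impI allI)
      fix r assume "x \<in> \<Omega>" and r: "0 < r \<and> r \<le> ?e"
      let ?z = "x + (r / 2) *\<^sub>R e"
      have k4: "?k \<le> 1/4" using L by (simp add: field_simps)
      have xR: "ball x r \<subseteq> ball a R"
        using r x by (auto simp: ball_subset_ball_iff dist_commute)
      have "x \<in> ball a R" using xR r by force
      then have gx: "g (x - (x \<bullet> e) *\<^sub>R e) < x \<bullet> e"
        using chart \<open>x \<in> \<Omega>\<close> by blast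
      have "y \<in> \<Omega> \<inter> ball x r" if y: "y \<in> ball ?z (?e * r)" for y
      proof -
        define w where "w = y - ?z"
        have "?e * r \<le> ?k * r" using r by (intro mult_right_mono) auto
        then have w: "norm w < ?k * r" using y by (simp add: w_def dist_norm norm_minus_commute)
        have yx: "y = x + (r/2) *\<^sub>R e + w" by (simp add: w_def)
        have we: "\<bar>w \<bullet> e\<bar> \<le> norm w" using Cauchy_Schwarz_ineq2[of w e] e by simp
        have "norm (y - x) \<le> r/2 + norm w"
          unfolding yx using norm_triangle_ineq[of "(r/2) *\<^sub>R e" w] r e by simp
        moreover have "?k * r \<le> 1/4 * r" using k4 r by (intro mult_right_mono) auto
        ultimately have "norm (y - x) < r" using w r by linarith
        then have yr: "y \<in> ball x r" by (simp add: dist_norm norm_minus_commute)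
        let ?y' = "y - (y \<bullet> e) *\<^sub>R e" and ?x' = "x - (x \<bullet> e) *\<^sub>R e"
        have diff: "?y' - ?x' = w - (w \<bullet> e) *\<^sub>R e"
          unfolding yx by (simp add: inner_add_left ee algebra_simps)
        \<comment> \<open>The projection onto the hyperplane does not increase norms.\<close>
        have "(norm (w - (w \<bullet> e) *\<^sub>R e))\<^sup>2 = (norm w)\<^sup>2 - (w \<bullet> e)\<^sup>2"
          unfolding power2_norm_eq_inner
          by (simp add: inner_diff_left inner_diff_right ee inner_commute power2_eq_square)
        then have "(norm (w - (w \<bullet> e) *\<^sub>R e))\<^sup>2 \<le> (norm w)\<^sup>2" by simp
        then have nd: "norm (w - (w \<bullet> e) *\<^sub>R e) \<le> norm w" by (rule power2_le_imp_le) simp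
        have "dist (g ?y') (g ?x') \<le> L * dist ?y' ?x'"
          by (rule lipschitz_onD[OF e(3)]) (simp_all add: inner_diff_left ee)
        also have "\<dots> \<le> L * norm w"
          unfolding dist_norm diff using nd L by (rule mult_left_mono)
        finally have "g ?y' \<le> g ?x' + L * norm w" by (simp add: dist_real_def)
        moreover have "L * norm w + norm w \<le> r / 4"
        proof -
          have "(L + 1) * norm w \<le> (L + 1) * (?k * r)"
            using w L by (intro mult_left_mono) auto
          also have "\<dots> = r / 4" using L by (simp add: field_simps)
          finally show ?thesis by (simp add: algebra_simps)
        qed
        moreover have "y \<bullet> e = x \<bullet> e + r/2 + w \<bullet> e"
          unfolding yx by (simp add: inner_add_left ee)
        ultimately have "g ?y' < y \<bullet> e"
          using gx we r by linarith
        then show ?thesis using chart yr xR by blast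
      qed
      then show "\<exists>z. ball z (?e * r) \<subseteq> \<Omega> \<inter> ball x r" by blast
    qed
    moreover have "?e > 0" using e L by simp
    ultimately show ?thesis by blast
  qed
  ultimately obtain k where k: "0 < k" "\<And>x. x \<in> closure \<Omega> \<Longrightarrow> P x k"
    by (rule compact_uniform_radius) blast+
  show thesis
  proof (rule that[OF k(1)])
    fix x r assume "x \<in> \<Omega>" "0 < r" "r \<le> k"
    then show "\<exists>z. ball z (k * r) \<subseteq> \<Omega> \<inter> ball x r"
      using k(2)[of x] closure_subset[of \<Omega>] by (auto simp: P_def)
  qed
qed

lemma lipschitz_domain_measure_density:
  fixes \<Omega> :: "'a::euclidean_space set"
  assumes "bounded_lipschitz_domain \<Omega>"
  obtains c r0 where "0 < c" "0 < r0"
    "\<And>x r. x \<in> \<Omega> \<Longrightarrow> 0 < r \<Longrightarrow> r \<le> r0 \<Longrightarrow> c * r ^ DIM('a) \<le> measure lebesgue (\<Omega> \<inter> ball x r)"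
proof -
  from assms have om: "open \<Omega>" "bounded \<Omega>" by (auto simp: bounded_lipschitz_domain_def)
  obtain k where k: "0 < k"
    "\<And>x r. x \<in> \<Omega> \<Longrightarrow> 0 < r \<Longrightarrow> r \<le> k \<Longrightarrow> \<exists>z. ball z (k * r) \<subseteq> \<Omega> \<inter> ball x r"
    using lipschitz_domain_interior_balls[OF assms] by metis
  let ?c = "unit_ball_vol (real DIM('a)) * k ^ DIM('a)"
  show thesis
  proof (rule that)
    show "0 < ?c" using k(1) by simp
    fix x r assume xr: "x \<in> \<Omega>" "0 < r" "r \<le> k"
    then obtain z where z: "ball z (k * r) \<subseteq> \<Omega> \<inter> ball x r" using k(2) by blast
    have "?c * r ^ DIM('a) = measure lebesgue (ball z (k * r))"
      using k(1) xr content_ball[of "k * r" z] by (simp add: power_mult_distrib)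
    also have "\<dots> \<le> measure lebesgue (\<Omega> \<inter> ball x r)"
      using om by (intro measure_mono_fmeasurable[OF z]) (auto intro: lmeasurable_open bounded_Int)
    finally show "?c * r ^ DIM('a) \<le> measure lebesgue (\<Omega> \<inter> ball x r)" .
  qed (fact k(1))
qed


section \<open>Local minima on the diagonal\<close>

text \<open>For each \<open>b\<close> the set \<open>{y \<in> K. f (b, b) \<le> f (y, y)}\<close> is closed by continuity and open
  because each of its points is a local minimum. It contains \<open>b\<close>, so it is all of \<open>K\<close>. Exchanging
  the roles of two points gives equality.\<close>

lemma diagonal_local_min_imp_constant:
  fixes K :: "'a::metric_space set" and f :: "'a \<times> 'a \<Rightarrow> real"
  assumes K: "connected K" "a \<in> K"
    and cont: "continuous_on (K \<times> K) f"
    and lmin: "\<And>x. x \<in> K \<Longrightarrow> local_min_point (K \<times> K) f (x, x)"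
    and x: "x \<in> K"
  shows "f (x, x) = f (a, a)"
proof -
  have cd: "continuous_on K (\<lambda>x. f (x, x))"
    by (rule continuous_on_compose2[OF cont]) (auto intro!: continuous_intros)
  have "{y \<in> K. f (b, b) \<le> f (y, y)} = K" if "b \<in> K" for b
  proof -
    let ?A = "{y \<in> K. f (b, b) \<le> f (y, y)}"
    have "closedin (top_of_set K) ?A"
      using continuous_closedin_preimage[OF cd closed_atLeast[of "f (b, b)"]]
      by (simp add: vimage_def Int_def conj_commute)
    moreover have "openin (top_of_set K) ?A"
      unfolding openin_contains_ball
    proof (intro conjI ballI)
      fix y assume "y \<in> ?A"
      then have y: "y \<in> K" "f (b, b) \<le> f (y, y)" by auto
      obtain d where d: "d > 0" "\<And>z. z \<in> K \<times> K \<Longrightarrow> z \<noteq> (y, y) \<Longrightarrow> dist z (y, y) < d \<Longrightarrow> f (y, y) \<le> f z"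
        using lmin[OF y(1)] unfolding local_min_point_def eventually_at by blast
      have "f (y, y) \<le> f (w, w)" if "w \<in> K" "w \<in> ball y (d/2)" for w
      proof (cases "w = y")
        case False
        have "dist (w, w) (y, y) \<le> dist w y + dist w y"
          using sqrt_sum_squares_le_sum_abs[of "dist w y" "dist w y"] by (simp add: dist_Pair_Pair)
        also have "\<dots> < d" using that by (simp add: dist_commute)
        finally show ?thesis using d(2)[of "(w, w)"] that False by auto
      qed simp
      then have "ball y (d/2) \<inter> K \<subseteq> ?A" using y by force
      then show "\<exists>e>0. ball y e \<inter> K \<subseteq> ?A" using d(1) by (intro exI[of _ "d/2"]) auto
    qed auto
    ultimately have "?A = {} \<or> ?A = K" using K(1) unfolding connected_clopen by blast
    then show ?thesis using that by auto
  qed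
  from this[OF K(2)] this[OF x] show ?thesis using K(2) x by (smt (verit) mem_Collect_eq)
qed

text \<open>The radius of a local minimum depends on the point. Since the value on the diagonal is the
  same everywhere, compactness gives a neighbourhood of the diagonal of uniform width.\<close>

lemma diagonal_local_min_imp_ge_near_diagonal:
  fixes K :: "'a::metric_space set" and f :: "'a \<times> 'a \<Rightarrow> real"
  assumes K: "compact K"
    and lmin: "\<And>x. x \<in> K \<Longrightarrow> local_min_point (K \<times> K) f (x, x)"
    and const: "\<And>x. x \<in> K \<Longrightarrow> f (x, x) = m"
  obtains d where "0 < d" "\<And>x y. x \<in> K \<Longrightarrow> y \<in> K \<Longrightarrow> dist x y < d \<Longrightarrow> m \<le> f (x, y)"
proof -
  define P where "P x e \<longleftrightarrow> (\<forall>y\<in>K. dist x y < e \<longrightarrow> m \<le> f (x, y))" for x e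
  have "\<exists>e>0. \<forall>x\<in>K \<inter> ball a e. P x e" if a: "a \<in> K" for a
  proof -
    obtain d where d: "d > 0" "\<And>z. z \<in> K \<times> K \<Longrightarrow> z \<noteq> (a, a) \<Longrightarrow> dist z (a, a) < d \<Longrightarrow> f (a, a) \<le> f z"
      using lmin[OF a] unfolding local_min_point_def eventually_at by blast
    have "m \<le> f (x, y)" if "x \<in> K" "y \<in> K" "x \<in> ball a (d/3)" "dist x y < d/3" for x y
    proof (cases "(x, y) = (a, a)")
      case False
      have "dist (x, y) (a, a) \<le> dist x a + dist y a"
        using sqrt_sum_squares_le_sum_abs[of "dist x a" "dist y a"] by (simp add: dist_Pair_Pair)
      also have "\<dots> < d"
        using that dist_triangle2[of y a x] by (simp add: dist_commute)
      finally show ?thesis using d(2)[of "(x, y)"] that False const[OF a] by auto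
    qed (use const[OF a] in auto)
    then show ?thesis using d(1) by (intro exI[of _ "d/3"]) (auto simp: P_def)
  qed
  moreover have "P x d" if "P x e" "d \<le> e" for x d e
    using that by (auto simp: P_def)
  ultimately obtain e where "0 < e" "\<And>x. x \<in> K \<Longrightarrow> P x e"
    using compact_uniform_radius[OF K, of P] by metis
  then show thesis using that[of e] by (auto simp: P_def)
qed


section \<open>Difference quotients and superlevel sets\<close>

abbreviation sobolev_kernel ::
    "('a::euclidean_space \<times> 'a \<Rightarrow> real) \<Rightarrow> ('a \<times> 'a \<Rightarrow> real) \<Rightarrow> ('a \<Rightarrow> real) \<Rightarrow> 'a \<Rightarrow> 'a \<Rightarrow> real"
  where
  "sobolev_kernel s p u x y \<equiv>
     \<bar>u x - u y\<bar> powr p (x, y) / norm (x - y) powr (real DIM('a) + s (x, y) * p (x, y))"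

lemma superlevel_set_lmeasurable:
  fixes \<Omega> :: "'a::euclidean_space set" and v :: "'a \<Rightarrow> real"
  assumes "\<Omega> \<in> lmeasurable" and v: "v \<in> borel_measurable (lebesgue_on \<Omega>)"
  shows "{x \<in> \<Omega>. t < v x} \<in> lmeasurable"
proof -
  have "{x \<in> \<Omega>. t < v x} \<in> sets (lebesgue_on \<Omega>)"
    using borel_measurable_less[OF borel_measurable_const v, of t] by (simp add: pred_def)
  then have "{x \<in> \<Omega>. t < v x} \<in> sets lebesgue"
    using assms sets_restrict_space_iff[of \<Omega> lebesgue] fmeasurableD by auto
  then show ?thesis using assms(1) by (rule fmeasurableI2[rotated 2]) auto
qed

lemma nn_integral_lebesgue_on_indicator:
  fixes \<Omega> :: "'a::euclidean_space set"
  assumes "\<Omega> \<in> lmeasurable" "A \<in> lmeasurable" "A \<subseteq> \<Omega>" "0 \<le> k"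
  shows "(\<integral>\<^sup>+x. ennreal k * indicator A x \<partial>lebesgue_on \<Omega>) = ennreal (k * measure lebesgue A)"
proof -
  have "A \<in> sets (lebesgue_on \<Omega>)"
    using assms sets_restrict_space_iff[of \<Omega> lebesgue] fmeasurableD by blast
  moreover have "emeasure (lebesgue_on \<Omega>) A = ennreal (measure lebesgue A)"
    using assms
    by (subst emeasure_restrict_space) (auto simp: emeasure_eq_measure2 dest: fmeasurableD)
  ultimately show ?thesis using assms by (simp add: nn_integral_cmult_indicator ennreal_mult)
qed

text \<open>If \<open>v\<close> exceeds half its value at \<open>y\<close> on at most half of the ball, then on the other half the
  numerator of the kernel is at least \<open>(v y / 2) powr p (x, y)\<close>. The bounds \<open>v y / 2 \<ge> 1\<close> and
  \<open>r \<le> 1\<close> give powers the right monotonicity in the exponent: passing from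
  \<open>p (x, y)\<close> and \<open>s (x, y)\<close> down to \<open>p0\<close> and \<open>s0\<close> lowers the numerator and raises the
  denominator.\<close>

lemma kernel_integral_lower_bound:
  fixes \<Omega> :: "'a::euclidean_space set"
  assumes \<Omega>: "\<Omega> \<in> lmeasurable" and v: "v \<in> borel_measurable (lebesgue_on \<Omega>)"
    and y: "y \<in> \<Omega>" "2 \<le> v y"
    and r: "0 < r" "r \<le> 1"
    and near: "\<And>x. x \<in> \<Omega> \<Longrightarrow> dist x y < r \<Longrightarrow> p0 \<le> p (x, y) \<and> s0 \<le> s (x, y)"
    and pos: "0 < p0" "0 < s0"
    and m: "m \<le> measure lebesgue (\<Omega> \<inter> ball y r)"
    and E: "measure lebesgue {x \<in> \<Omega>. v y / 2 < v x} \<le> m / 2"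
  shows "ennreal (m / 2 * ((v y / 2) powr p0 / r powr (real DIM('a) + s0 * p0)))
           \<le> (\<integral>\<^sup>+x. ennreal (sobolev_kernel s p v x y) \<partial>lebesgue_on \<Omega>)"
proof -
  let ?M = "lebesgue_on \<Omega>"
  let ?E = "{x \<in> \<Omega>. v y / 2 < v x}" and ?B = "\<Omega> \<inter> ball y r"
  let ?k = "(v y / 2) powr p0 / r powr (real DIM('a) + s0 * p0)"
  have BL: "?B \<in> lmeasurable" using \<Omega> by (intro fmeasurable_Int_fmeasurable) auto
  have EF: "?E \<in> lmeasurable" using \<Omega> v by (rule superlevel_set_lmeasurable)
  have D: "?B - ?E \<in> lmeasurable" using BL EF by (rule fmeasurable.Diff)
  have "m / 2 \<le> measure lebesgue ?B - measure lebesgue ?E"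
    using m E by simp
  also have "\<dots> \<le> measure lebesgue (?B - ?E)"
  proof -
    have "measure lebesgue ?B \<le> measure lebesgue ((?B - ?E) \<union> ?E)"
      using D EF by (intro measure_mono_fmeasurable) (use BL in auto)
    also have "\<dots> \<le> measure lebesgue (?B - ?E) + measure lebesgue ?E"
      using D EF by (intro measure_Un_le) auto
    finally show ?thesis by simp
  qed
  finally have mD: "m / 2 \<le> measure lebesgue (?B - ?E)" .
  have ker: "?k \<le> sobolev_kernel s p v x y" if x: "x \<in> ?B - ?E" for x
  proof -
    \<comment> \<open>The center has a value above \<open>v y / 2\<close>, so the junk value of the kernel on the diagonal is avoided.\<close>
    have "x \<noteq> y" using x y by auto
    then have n: "0 < norm (x - y)" "norm (x - y) \<le> r" "norm (x - y) \<le> 1"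
      using x r by (auto simp: dist_norm norm_minus_commute)
    have nr: "p0 \<le> p (x, y)" "s0 \<le> s (x, y)"
      using near[of x] x by (auto simp: dist_commute)
    have "v x \<le> v y / 2" using x by (simp add: not_less)
    then have d: "v y / 2 \<le> \<bar>v x - v y\<bar>" by linarith
    have "(v y / 2) powr p0 \<le> (v y / 2) powr p (x, y)"
      using y nr by (intro powr_mono) auto
    also have "\<dots> \<le> \<bar>v x - v y\<bar> powr p (x, y)"
      using y nr pos d by (intro powr_mono2) auto
    finally have num: "(v y / 2) powr p0 \<le> \<bar>v x - v y\<bar> powr p (x, y)" .
    have "s0 * p0 \<le> s (x, y) * p (x, y)"
      using nr pos by (intro mult_mono) auto
    then have "norm (x - y) powr (real DIM('a) + s (x, y) * p (x, y))
        \<le> norm (x - y) powr (real DIM('a) + s0 * p0)"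
      using n by (intro powr_mono') auto
    also have "\<dots> \<le> r powr (real DIM('a) + s0 * p0)"
      using n pos by (intro powr_mono2) auto
    finally show ?thesis using num n by (intro frac_le) auto
  qed
  have "ennreal (m / 2 * ?k) \<le> ennreal (measure lebesgue (?B - ?E) * ?k)"
    using mD by (intro ennreal_leI mult_right_mono) auto
  also have "\<dots> = (\<integral>\<^sup>+x. ennreal ?k * indicator (?B - ?E) x \<partial>?M)"
    by (subst nn_integral_lebesgue_on_indicator[OF \<Omega> D]) (auto simp: mult.commute)
  also have "\<dots> \<le> (\<integral>\<^sup>+x. ennreal (sobolev_kernel s p v x y) \<partial>?M)"
    using ker by (intro nn_integral_mono) (auto simp: indicator_def intro!: ennreal_leI)
  finally show ?thesis .
qed

text \<open>Chebyshev's inequality.\<close>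

lemma measure_superlevel_le:
  fixes \<Omega> :: "'a::euclidean_space set"
  assumes \<Omega>: "\<Omega> \<in> lmeasurable" and v: "v \<in> borel_measurable (lebesgue_on \<Omega>)"
    and t: "0 < t" and a: "0 < a" and I: "0 \<le> I"
    and int: "(\<integral>\<^sup>+x. ennreal (\<bar>v x\<bar> powr a) \<partial>lebesgue_on \<Omega>) \<le> ennreal I"
  shows "measure lebesgue {x \<in> \<Omega>. t < v x} \<le> I / t powr a"
proof -
  let ?M = "lebesgue_on \<Omega>" and ?E = "{x \<in> \<Omega>. t < v x}"
  have E: "?E \<in> lmeasurable" using \<Omega> v by (rule superlevel_set_lmeasurable)
  have "ennreal (t powr a * measure lebesgue ?E)
      = (\<integral>\<^sup>+x. ennreal (t powr a) * indicator ?E x \<partial>?M)"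
    by (rule nn_integral_lebesgue_on_indicator[symmetric, OF \<Omega> E]) auto
  also have "\<dots> \<le> (\<integral>\<^sup>+x. ennreal (\<bar>v x\<bar> powr a) \<partial>?M)"
    using t a by (intro nn_integral_mono) (auto simp: indicator_def intro!: ennreal_leI powr_mono2)
  also note int
  finally have "t powr a * measure lebesgue ?E \<le> I" using I by simp
  then show ?thesis using t by (simp add: field_simps)
qed


section \<open>The integral of the critical power\<close>

text \<open>If the constant term does not account for half of \<open>T\<close>, then the power does, and
  \<open>T \<le> 2 * B * T powr \<theta>\<close> can be solved for \<open>T\<close> as \<open>\<theta> < 1\<close>.\<close>

lemma le_sublinear_power_imp_bounded:
  fixes T :: real
  assumes "0 \<le> \<alpha>" "0 \<le> T" "0 < \<theta>" "\<theta> < 1" "0 \<le> B"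
    and T: "T \<le> \<alpha> + B * T powr \<theta>"
  shows "T \<le> max (2 * \<alpha>) ((2 * B) powr (1 / (1 - \<theta>)))"
proof (cases "T \<le> 2 * \<alpha>")
  case False
  then have T0: "0 < T" using assms by linarith
  have "T \<le> 2 * B * T powr \<theta>" using False T by simp
  then have "T * T powr (- \<theta>) \<le> 2 * B"
    using T0 by (simp add: powr_minus field_simps)
  then have "T powr (1 - \<theta>) \<le> 2 * B"
    using T0 by (simp add: powr_diff powr_minus divide_inverse)
  then have "(T powr (1 - \<theta>)) powr (1 / (1 - \<theta>)) \<le> (2 * B) powr (1 / (1 - \<theta>))"
    using assms by (intro powr_mono2) auto
  then show ?thesis using T0 assms by (simp add: powr_powr)
qed simp

text \<open>Boundedness of \<open>v\<close> guarantees that \<open>T = \<integral> v\<^sup>P\<close> is finite, which the absorption argument needs.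
  The constant \<open>K\<close> does not depend on the bound \<open>b\<close>, so the estimate survives the limit of
  truncations.\<close>

lemma critical_power_integral_bound_bounded:
  fixes \<Omega> :: "'a::euclidean_space set" and p s :: "'a \<times> 'a \<Rightarrow> real"
  assumes \<Omega>: "\<Omega> \<in> lmeasurable"
    and pos: "0 < p0" "0 < s0" "s0 * p0 < real DIM('a)"
    and c: "0 < c" and r0: "0 < r0" "r0 \<le> 1"
    and density: "\<And>x r. x \<in> \<Omega> \<Longrightarrow> 0 < r \<Longrightarrow> r \<le> r0 \<Longrightarrow> c * r ^ DIM('a) \<le> measure lebesgue (\<Omega> \<inter> ball x r)"
    and near: "\<And>x y. x \<in> \<Omega> \<Longrightarrow> y \<in> \<Omega> \<Longrightarrow> dist x y < r0 \<Longrightarrow> p0 \<le> p (x, y) \<and> s0 \<le> s (x, y)"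
  shows "\<exists>K\<ge>0. \<forall>v b. v \<in> borel_measurable (lebesgue_on \<Omega>) \<longrightarrow> (\<forall>x\<in>\<Omega>. 0 \<le> v x \<and> v x \<le> b) \<longrightarrow>
      (\<integral>\<^sup>+y. (\<integral>\<^sup>+x. ennreal (sobolev_kernel s p v x y) \<partial>lebesgue_on \<Omega>) \<partial>lebesgue_on \<Omega>) \<le> 1 \<longrightarrow>
      (\<integral>\<^sup>+x. ennreal (\<bar>v x\<bar> powr p0) \<partial>lebesgue_on \<Omega>) \<le> 1 \<longrightarrow>
      nakano_modular \<Omega> (\<lambda>_. real DIM('a) * p0 / (real DIM('a) - p0 * s0)) v \<le> ennreal K"
proof -
  define N where "N = real DIM('a)"
  define \<theta> where "\<theta> = s0 * p0 / N"
  define P where "P = N * p0 / (N - p0 * s0)"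
  define \<tau>0 where "\<tau>0 = max 2 (2 * (2 / (c * r0 ^ DIM('a))) powr (1 / p0))"
  define A where "A = (c / 2) powr (1 + \<theta>) * (1 / 2) powr P"
  define \<alpha> where "\<alpha> = \<tau>0 powr P * measure lebesgue \<Omega>"
  let ?M = "lebesgue_on \<Omega>"
  have N0: "0 < N" by (simp add: N_def)
  have \<theta>: "0 < \<theta>" "\<theta> < 1" using pos N0 by (auto simp: \<theta>_def N_def)
  have d0: "0 < N - p0 * s0" using pos by (simp add: N_def mult.commute)
  have P0: "0 < P" using N0 d0 pos by (simp add: P_def)
  \<comment> \<open>This identity is what makes \<open>P\<close> the critical exponent: it turns the lower bound for the kernel
    integral into one by the power \<open>P\<close> itself.\<close>
  have P\<theta>: "P * \<theta> + p0 = P" using N0 d0 by (simp add: P_def \<theta>_def field_simps)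
  have A0: "0 < A" using c by (simp add: A_def)
  have \<tau>0: "2 \<le> \<tau>0" by (simp add: \<tau>0_def)
  have \<alpha>0: "0 \<le> \<alpha>" by (simp add: \<alpha>_def)
  have bound: "(\<integral>\<^sup>+x. ennreal (\<bar>v x\<bar> powr P) \<partial>?M) \<le> ennreal (max (2 * \<alpha>) ((2 * (1 / A)) powr (1 / (1 - \<theta>))))"
    if v: "v \<in> borel_measurable ?M" and vb: "\<And>x. x \<in> \<Omega> \<Longrightarrow> 0 \<le> v x \<and> v x \<le> b"
      and G1: "(\<integral>\<^sup>+y. (\<integral>\<^sup>+x. ennreal (sobolev_kernel s p v x y) \<partial>?M) \<partial>?M) \<le> 1"
      and L1: "(\<integral>\<^sup>+x. ennreal (\<bar>v x\<bar> powr p0) \<partial>?M) \<le> 1" for v b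
  proof -
    define G where "G y = (\<integral>\<^sup>+x. ennreal (sobolev_kernel s p v x y) \<partial>?M)" for y
    define I where "I = (\<integral>\<^sup>+x. ennreal (\<bar>v x\<bar> powr P) \<partial>?M)"
    have const: "(\<integral>\<^sup>+x. ennreal k \<partial>?M) = ennreal (k * measure lebesgue \<Omega>)" if "0 \<le> k" for k
    proof -
      have "(\<integral>\<^sup>+x. ennreal k \<partial>?M) = (\<integral>\<^sup>+x. ennreal k * indicator \<Omega> x \<partial>?M)"
        by (intro nn_integral_cong) simp
      then show ?thesis using nn_integral_lebesgue_on_indicator[OF \<Omega> \<Omega> _ that] by simp
    qed
    have "I \<le> (\<integral>\<^sup>+x. ennreal (b powr P) \<partial>?M)"
      unfolding I_def using vb P0 by (intro nn_integral_mono ennreal_leI powr_mono2) auto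
    also have "\<dots> < \<infinity>" by (subst const) auto
    finally obtain T where T: "0 \<le> T" "I = ennreal T"
      by (cases I) auto
    have "T \<le> \<alpha> + (1 / A) * T powr \<theta>"
    proof (cases "T = 0")
      case True then show ?thesis using \<alpha>0 by simp
    next
      case False
      with T have T0: "0 < T" by simp
      have low: "ennreal (A * T powr (-\<theta>) * v y powr P) \<le> G y" if y: "y \<in> \<Omega>" "\<tau>0 \<le> v y" for y
      proof -
        \<comment> \<open>The value \<open>w\<close> stands for \<open>r\<^sup>N\<close>. Chebyshev with exponent \<open>P\<close> bounds the superlevel set
          by \<open>c / 2 * Z\<close>. Where \<open>Z\<close> would push \<open>r\<close> beyond \<open>r0\<close>, Chebyshev with exponent \<open>p0\<close>
          and the choice of \<open>\<tau>0\<close> yield the bound \<open>c / 2 * r0\<^sup>N\<close> instead.\<close>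
        define h where "h = v y / 2"
        have h: "1 \<le> h" "2 \<le> v y" using y \<tau>0 by (auto simp: h_def)
        define Z where "Z = (2 / c) * (T / h powr P)"
        define w where "w = min (r0 ^ DIM('a)) Z"
        define r where "r = w powr (1 / N)"
        have Z0: "0 < Z" using c T0 h by (simp add: Z_def)
        have w0: "0 < w" using Z0 r0 by (simp add: w_def)
        have rN: "r ^ DIM('a) = w"
          using w0 N0 by (simp add: r_def powr_powr N_def flip: powr_realpow)
        have rpos: "0 < r" using w0 by (simp add: r_def)
        have rr0: "r \<le> r0"
        proof (rule ccontr)
          assume "\<not> r \<le> r0"
          then have "r0 ^ DIM('a) < r ^ DIM('a)" using r0 by (intro power_strict_mono) auto
          then show False by (simp add: rN w_def)
        qed
        have "measure lebesgue {x \<in> \<Omega>. h < v x} \<le> T / h powr P"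
          using T v h P0 by (intro measure_superlevel_le[OF \<Omega>]) (auto simp: I_def)
        then have E1: "measure lebesgue {x \<in> \<Omega>. h < v x} \<le> c / 2 * Z"
          using c by (simp add: Z_def)
        have "measure lebesgue {x \<in> \<Omega>. h < v x} \<le> 1 / h powr p0"
          using v h pos L1 by (intro measure_superlevel_le[OF \<Omega>]) auto
        moreover have "2 / (c * r0 ^ DIM('a)) \<le> h powr p0"
        proof -
          have "2 / (c * r0 ^ DIM('a)) = ((2 / (c * r0 ^ DIM('a))) powr (1 / p0)) powr p0"
            using c r0 pos by (simp add: powr_powr)
          also have "\<dots> \<le> h powr p0"
            using y(2) pos by (intro powr_mono2) (auto simp: h_def \<tau>0_def)
          finally show ?thesis .
        qed
        then have "1 / h powr p0 \<le> c / 2 * r0 ^ DIM('a)"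
          using c r0 h by (simp add: field_simps)
        ultimately have "measure lebesgue {x \<in> \<Omega>. h < v x} \<le> c / 2 * r0 ^ DIM('a)" by simp
        with E1 have E: "measure lebesgue {x \<in> \<Omega>. v y / 2 < v x} \<le> (c * w) / 2"
          by (auto simp: w_def h_def min_def)
        have lb: "ennreal ((c * w) / 2 * (h powr p0 / r powr (real DIM('a) + s0 * p0))) \<le> G y"
          unfolding G_def h_def
          by (rule kernel_integral_lower_bound[OF \<Omega> v y(1) h(2) rpos _ _ pos(1,2) _ E])
             (use rr0 r0 near y density[OF y(1) rpos rr0] in \<open>auto simp: rN\<close>)
        have "r powr (real DIM('a) + s0 * p0) = w * w powr \<theta>"
        proof -
          have "(1 / N) * (real DIM('a) + s0 * p0) = 1 + \<theta>"
            using N0 by (simp add: \<theta>_def N_def field_simps)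
          then have "r powr (real DIM('a) + s0 * p0) = w powr (1 + \<theta>)"
            unfolding r_def powr_powr by simp
          then show ?thesis using w0 by (simp add: powr_add)
        qed
        then have eq: "(c * w) / 2 * (h powr p0 / r powr (real DIM('a) + s0 * p0))
            = c / 2 * h powr p0 * w powr (-\<theta>)"
          using w0 by (simp add: powr_minus_divide)
        have "w powr (-\<theta>) \<ge> Z powr (-\<theta>)"
          using w0 \<theta> by (intro powr_mono2') (auto simp: w_def)
        then have "c / 2 * h powr p0 * Z powr (-\<theta>) \<le> c / 2 * h powr p0 * w powr (-\<theta>)"
          using c by (intro mult_left_mono) auto
        moreover have "A * T powr (-\<theta>) * v y powr P = c / 2 * h powr p0 * Z powr (-\<theta>)"
        proof -
          have Zp: "Z powr (-\<theta>) = (c / 2) powr \<theta> * (T powr (-\<theta>) * h powr (P * \<theta>))"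
            unfolding Z_def using c T0 h
            by (simp add: powr_mult powr_divide powr_minus powr_powr field_simps)
          have "h powr p0 * h powr (P * \<theta>) = h powr P"
            using P\<theta> by (simp add: add.commute flip: powr_add)
          also have "\<dots> = (1/2) powr P * v y powr P"
            using h by (simp add: h_def flip: powr_mult)
          finally have hp: "h powr p0 * h powr (P * \<theta>) = (1/2) powr P * v y powr P" .
          have "c / 2 * h powr p0 * Z powr (-\<theta>)
              = c / 2 * (c / 2) powr \<theta> * T powr (-\<theta>) * (h powr p0 * h powr (P * \<theta>))"
            unfolding Zp by (simp only: mult_ac)
          also have "\<dots> = ((c / 2) * (c / 2) powr \<theta> * (1 / 2) powr P) * T powr (-\<theta>) * v y powr P"
            unfolding hp by (simp only: mult_ac)
          also have "(c / 2) * (c / 2) powr \<theta> * (1 / 2) powr P = A"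
            using c by (simp add: A_def powr_add)
          finally show ?thesis by (rule sym)
        qed
        ultimately have "A * T powr (-\<theta>) * v y powr P
            \<le> (c * w) / 2 * (h powr p0 / r powr (real DIM('a) + s0 * p0))"
          unfolding eq by simp
        then show ?thesis using lb by (rule order.trans[OF ennreal_leI])
      qed
      \<comment> \<open>Constants may be pulled out of the integral of a measurable function such as \<open>v\<^sup>P\<close>, so the
        factor \<open>A * T powr (- \<theta>)\<close> stays on that side and \<open>G\<close> enters only by monotonicity.\<close>
      define H where "H = {y \<in> \<Omega>. \<tau>0 \<le> v y}"
      have HM: "H \<in> sets ?M"
        using borel_measurable_le[OF borel_measurable_const v, of \<tau>0]
        by (simp add: H_def pred_def)
      define J where "J = (\<integral>\<^sup>+y. ennreal (v y powr P) * indicator H y \<partial>?M)"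
      have mJ: "(\<lambda>y. ennreal (v y powr P) * indicator H y) \<in> borel_measurable ?M"
        using v HM by measurable
      have "ennreal (A * T powr (-\<theta>)) * J =
          (\<integral>\<^sup>+y. ennreal (A * T powr (-\<theta>)) * (ennreal (v y powr P) * indicator H y) \<partial>?M)"
        unfolding J_def using mJ by (simp add: nn_integral_cmult)
      also have "\<dots> \<le> (\<integral>\<^sup>+y. G y \<partial>?M)"
      proof (intro nn_integral_mono)
        fix y
        show "ennreal (A * T powr (-\<theta>)) * (ennreal (v y powr P) * indicator H y) \<le> G y"
          using low[of y] A0 by (auto simp: H_def indicator_def ennreal_mult)
      qed
      also have "\<dots> \<le> 1" using G1 by (simp add: G_def)
      finally have J1: "ennreal (A * T powr (-\<theta>)) * J \<le> 1" .
      have "I \<le> (\<integral>\<^sup>+y. ennreal (\<tau>0 powr P) + ennreal (v y powr P) * indicator H y \<partial>?M)"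
        unfolding I_def
      proof (intro nn_integral_mono)
        fix y assume "y \<in> space ?M"
        then have y: "y \<in> \<Omega>" by simp
        show "ennreal (\<bar>v y\<bar> powr P) \<le> ennreal (\<tau>0 powr P) + ennreal (v y powr P) * indicator H y"
        proof (cases "y \<in> H")
          case True then show ?thesis using vb[OF y] by simp
        next
          case False
          then have "\<bar>v y\<bar> powr P \<le> \<tau>0 powr P"
            using vb[OF y] y P0 by (intro powr_mono2) (auto simp: H_def)
          then show ?thesis using False by (simp add: ennreal_leI)
        qed
      qed
      also have "\<dots> = ennreal \<alpha> + J"
        unfolding J_def \<alpha>_def using mJ const[of "\<tau>0 powr P"] by (subst nn_integral_add) simp_all
      finally have IJ: "I \<le> ennreal \<alpha> + J" .
      have "J \<le> I"
        unfolding I_def J_def using vb by (intro nn_integral_mono) (auto simp: indicator_def)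
      then obtain j where j: "0 \<le> j" "J = ennreal j" using T by (cases J) (auto simp: top_unique)
      have "A * T powr (-\<theta>) * j \<le> 1"
        using J1 j A0 by (simp flip: ennreal_mult' ennreal_1)
      then have "j \<le> (1 / A) * T powr \<theta>"
        using A0 T0 by (simp add: powr_minus field_simps)
      moreover have "T \<le> \<alpha> + j" using IJ T j \<alpha>0 by (simp flip: ennreal_plus)
      ultimately show ?thesis by simp
    qed
    then have "T \<le> max (2 * \<alpha>) ((2 * (1 / A)) powr (1 / (1 - \<theta>)))"
      using \<alpha>0 T \<theta> A0 by (intro le_sublinear_power_imp_bounded) auto
    then show ?thesis using T by (simp add: I_def ennreal_leI)
  qed
  show ?thesis
  proof (intro exI[of _ "max (2 * \<alpha>) ((2 * (1 / A)) powr (1 / (1 - \<theta>)))"] conjI allI impI)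
    show "0 \<le> max (2 * \<alpha>) ((2 * (1 / A)) powr (1 / (1 - \<theta>)))" using \<alpha>0 by simp
  qed (use bound in \<open>auto simp: nakano_modular_def P_def N_def\<close>)
qed

text \<open>The truncations \<open>min \<bar>u\<bar> n\<close> are images of \<open>u\<close> under 1-Lipschitz maps that vanish at 0, so
  they do not increase the modular; they increase to \<open>\<bar>u\<bar>\<close>.\<close>

lemma critical_power_integral_bound:
  fixes \<Omega> :: "'a::euclidean_space set" and p s :: "'a \<times> 'a \<Rightarrow> real"
  assumes \<Omega>: "\<Omega> \<in> lmeasurable"
    and pos: "0 < p0" "0 < s0" "s0 * p0 < real DIM('a)"
    and ppos: "\<And>x y. x \<in> \<Omega> \<Longrightarrow> y \<in> \<Omega> \<Longrightarrow> 0 \<le> p (x, y)"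
    and diag: "\<And>x. x \<in> \<Omega> \<Longrightarrow> p (x, x) = p0"
    and c: "0 < c" and r0: "0 < r0" "r0 \<le> 1"
    and density: "\<And>x r. x \<in> \<Omega> \<Longrightarrow> 0 < r \<Longrightarrow> r \<le> r0 \<Longrightarrow> c * r ^ DIM('a) \<le> measure lebesgue (\<Omega> \<inter> ball x r)"
    and near: "\<And>x y. x \<in> \<Omega> \<Longrightarrow> y \<in> \<Omega> \<Longrightarrow> dist x y < r0 \<Longrightarrow> p0 \<le> p (x, y) \<and> s0 \<le> s (x, y)"
  shows "\<exists>K\<ge>0. \<forall>u. u \<in> borel_measurable (lebesgue_on \<Omega>) \<longrightarrow> sobolev_modular \<Omega> s p u < 1 \<longrightarrow>
      nakano_modular \<Omega> (\<lambda>_. real DIM('a) * p0 / (real DIM('a) - p0 * s0)) u \<le> ennreal K"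
proof -
  let ?M = "lebesgue_on \<Omega>" and ?P = "real DIM('a) * p0 / (real DIM('a) - p0 * s0)"
  have P0: "0 < ?P" using pos by (simp add: mult.commute)
  let ?bounded_case = "\<lambda>K. \<forall>v b. v \<in> borel_measurable (lebesgue_on \<Omega>) \<longrightarrow> (\<forall>x\<in>\<Omega>. 0 \<le> v x \<and> v x \<le> b) \<longrightarrow>
      (\<integral>\<^sup>+y. (\<integral>\<^sup>+x. ennreal (sobolev_kernel s p v x y) \<partial>lebesgue_on \<Omega>) \<partial>lebesgue_on \<Omega>) \<le> 1 \<longrightarrow>
      (\<integral>\<^sup>+x. ennreal (\<bar>v x\<bar> powr p0) \<partial>lebesgue_on \<Omega>) \<le> 1 \<longrightarrow>
      nakano_modular \<Omega> (\<lambda>_. ?P) v \<le> ennreal K"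
  have "\<exists>K\<ge>0. ?bounded_case K"
    using density near
    by (rule critical_power_integral_bound_bounded[OF \<Omega> pos c r0, where p = p and s = s])
  then obtain K where "0 \<le> K" and K: "?bounded_case K"
    by (elim exE conjE) (rule that)
  show ?thesis
  proof (intro exI[of _ K] conjI allI impI)
    fix u assume u: "u \<in> borel_measurable ?M" and mod: "sobolev_modular \<Omega> s p u < 1"
    define v where "v n x = min \<bar>u x\<bar> (real n)" for n x
    have vm: "v n \<in> borel_measurable ?M" for n
      unfolding v_def using u by measurable
    have i1: "(\<integral>\<^sup>+y. (\<integral>\<^sup>+x. ennreal (sobolev_kernel s p u x y) \<partial>?M) \<partial>?M) \<le> 1"
      using le_less_trans[OF _ mod] by (auto simp: sobolev_modular_def intro!: less_imp_le)
    have "(\<integral>\<^sup>+x. ennreal (\<bar>u x\<bar> powr p (x, x)) \<partial>?M) \<le> 1"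
      using le_less_trans[OF _ mod] by (auto simp: sobolev_modular_def intro!: less_imp_le)
    moreover have "(\<integral>\<^sup>+x. ennreal (\<bar>u x\<bar> powr p (x, x)) \<partial>?M) = (\<integral>\<^sup>+x. ennreal (\<bar>u x\<bar> powr p0) \<partial>?M)"
      using diag by (intro nn_integral_cong) auto
    ultimately have i2: "(\<integral>\<^sup>+x. ennreal (\<bar>u x\<bar> powr p0) \<partial>?M) \<le> 1" by simp
    have vK: "nakano_modular \<Omega> (\<lambda>_. ?P) (v n) \<le> ennreal K" for n
    proof (rule K[rule_format, OF vm, of _ "real n"])
      have "(\<integral>\<^sup>+y. (\<integral>\<^sup>+x. ennreal (sobolev_kernel s p (v n) x y) \<partial>?M) \<partial>?M)
          \<le> (\<integral>\<^sup>+y. (\<integral>\<^sup>+x. ennreal (sobolev_kernel s p u x y) \<partial>?M) \<partial>?M)"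
      proof (intro nn_integral_mono ennreal_leI divide_right_mono powr_mono2)
        fix x y show "\<bar>v n x - v n y\<bar> \<le> \<bar>u x - u y\<bar>" by (auto simp: v_def)
      qed (use ppos in auto)
      then show "(\<integral>\<^sup>+y. (\<integral>\<^sup>+x. ennreal (sobolev_kernel s p (v n) x y) \<partial>?M) \<partial>?M) \<le> 1"
        using i1 by (rule order.trans)
      have "(\<integral>\<^sup>+x. ennreal (\<bar>v n x\<bar> powr p0) \<partial>?M) \<le> (\<integral>\<^sup>+x. ennreal (\<bar>u x\<bar> powr p0) \<partial>?M)"
        using pos by (intro nn_integral_mono ennreal_leI powr_mono2) (auto simp: v_def)
      then show "(\<integral>\<^sup>+x. ennreal (\<bar>v n x\<bar> powr p0) \<partial>?M) \<le> 1" using i2 by (rule order.trans)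
    qed (auto simp: v_def)
    have "nakano_modular \<Omega> (\<lambda>_. ?P) u = (\<integral>\<^sup>+x. (SUP n. ennreal (\<bar>v n x\<bar> powr ?P)) \<partial>?M)"
      unfolding nakano_modular_def
    proof (intro nn_integral_cong antisym)
      fix x
      obtain n where "\<bar>u x\<bar> \<le> real n" using real_arch_simple by blast
      then have "\<bar>v n x\<bar> = \<bar>u x\<bar>" by (simp add: v_def)
      then show "ennreal (\<bar>u x\<bar> powr ?P) \<le> (SUP n. ennreal (\<bar>v n x\<bar> powr ?P))"
        by (intro SUP_upper2[of n]) auto
      show "(SUP n. ennreal (\<bar>v n x\<bar> powr ?P)) \<le> ennreal (\<bar>u x\<bar> powr ?P)"
        using P0 by (intro SUP_least ennreal_leI powr_mono2) (auto simp: v_def)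
    qed
    also have "\<dots> = (SUP n. \<integral>\<^sup>+x. ennreal (\<bar>v n x\<bar> powr ?P) \<partial>?M)"
    proof (rule nn_integral_monotone_convergence_SUP)
      show "incseq (\<lambda>n x. ennreal (\<bar>v n x\<bar> powr ?P))"
        using P0 by (auto intro!: incseq_SucI le_funI ennreal_leI powr_mono2 simp: v_def)
      show "(\<lambda>x. ennreal (\<bar>v n x\<bar> powr ?P)) \<in> borel_measurable ?M" for n
        using vm by measurable
    qed
    also have "\<dots> \<le> ennreal K" using vK unfolding nakano_modular_def by (intro SUP_least)
    finally show "nakano_modular \<Omega> (\<lambda>_. ?P) u \<le> ennreal K" .
  qed (fact \<open>0 \<le> K\<close>)
qed


section \<open>From the power bound to the embedding\<close>

text \<open>A bound on the modular becomes a bound on the norm by homogeneity: for \<open>C \<ge> 1\<close> and exponents at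
  least 1, dividing \<open>u\<close> by \<open>C\<close> divides the modular by at least \<open>C\<close>.\<close>

lemma continuous_embedding_if_power_bound:
  fixes \<Omega> :: "'a::euclidean_space set"
  assumes \<Omega>: "\<Omega> \<in> lmeasurable"
    and q: "\<And>x. x \<in> \<Omega> \<Longrightarrow> 1 \<le> q x \<and> q x \<le> P"
    and K: "0 \<le> K" "\<And>u. u \<in> borel_measurable (lebesgue_on \<Omega>) \<Longrightarrow> sobolev_modular \<Omega> s p u < 1 \<Longrightarrow>
      nakano_modular \<Omega> (\<lambda>_. P) u \<le> ennreal K"
  shows "continuous_embedding (sobolev_space \<Omega> s p) (sobolev_norm \<Omega> s p)
           (nakano_space \<Omega> q) (nakano_norm \<Omega> q)"
proof -
  let ?M = "lebesgue_on \<Omega>"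
  define C where "C = max 1 (measure lebesgue \<Omega> + K)"
  have C: "1 \<le> C" by (simp add: C_def)
  have one: "(\<integral>\<^sup>+x. 1 \<partial>?M) = ennreal (measure lebesgue \<Omega>)"
  proof -
    have "(\<integral>\<^sup>+x. 1 \<partial>?M) = (\<integral>\<^sup>+x. ennreal 1 * indicator \<Omega> x \<partial>?M)"
      by (intro nn_integral_cong) simp
    then show ?thesis using nn_integral_lebesgue_on_indicator[OF \<Omega> \<Omega>, of 1] by simp
  qed
  have pw: "\<bar>a\<bar> powr q x \<le> 1 + \<bar>a\<bar> powr P" if "x \<in> \<Omega>" for a :: real and x
  proof (cases "\<bar>a\<bar> \<le> 1")
    case True
    then have "\<bar>a\<bar> powr q x \<le> 1" using q[OF that] by (intro powr_le1) auto
    then show ?thesis using powr_ge_zero[of "\<bar>a\<bar>" P] by linarith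
  next
    case False
    then have "\<bar>a\<bar> powr q x \<le> \<bar>a\<bar> powr P" using q[OF that] by (intro powr_mono) auto
    then show ?thesis by simp
  qed
  have one_plus: "(\<integral>\<^sup>+x. ennreal (k * (1 + \<bar>u x\<bar> powr P)) \<partial>?M)
      = ennreal k * (ennreal (measure lebesgue \<Omega>) + nakano_modular \<Omega> (\<lambda>_. P) u)"
    if u: "u \<in> borel_measurable ?M" and k: "0 \<le> k" for u k
  proof -
    have m: "(\<lambda>x. ennreal (\<bar>u x\<bar> powr P)) \<in> borel_measurable ?M" using u by measurable
    have "(\<integral>\<^sup>+x. ennreal (k * (1 + \<bar>u x\<bar> powr P)) \<partial>?M)
        = (\<integral>\<^sup>+x. ennreal k * (1 + ennreal (\<bar>u x\<bar> powr P)) \<partial>?M)"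
      using k by (intro nn_integral_cong) (simp add: ennreal_mult ennreal_plus)
    also have "\<dots> = ennreal k * (\<integral>\<^sup>+x. 1 + ennreal (\<bar>u x\<bar> powr P) \<partial>?M)"
      using m by (intro nn_integral_cmult) auto
    also have "(\<integral>\<^sup>+x. 1 + ennreal (\<bar>u x\<bar> powr P) \<partial>?M)
        = ennreal (measure lebesgue \<Omega>) + nakano_modular \<Omega> (\<lambda>_. P) u"
      unfolding nakano_modular_def one[symmetric] using m by (intro nn_integral_add) simp_all
    finally show ?thesis .
  qed
  have unit: "nakano_modular \<Omega> q (\<lambda>x. u x / C) \<le> 1"
    if u: "u \<in> borel_measurable ?M" and mod: "sobolev_modular \<Omega> s p u < 1" for u
  proof -
    have "nakano_modular \<Omega> q (\<lambda>x. u x / C) \<le> (\<integral>\<^sup>+x. ennreal ((1 / C) * (1 + \<bar>u x\<bar> powr P)) \<partial>?M)"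
      unfolding nakano_modular_def
    proof (intro nn_integral_mono ennreal_leI)
      fix x assume "x \<in> space ?M"
      then have x: "x \<in> \<Omega>" by simp
      have "\<bar>u x / C\<bar> powr q x = (1 / C) powr q x * \<bar>u x\<bar> powr q x"
        using C by (simp flip: powr_mult)
      also have "\<dots> \<le> (1 / C) powr 1 * (1 + \<bar>u x\<bar> powr P)"
        using C q[OF x] pw[OF x] by (intro mult_mono powr_mono') auto
      finally show "\<bar>u x / C\<bar> powr q x \<le> (1 / C) * (1 + \<bar>u x\<bar> powr P)" using C by simp
    qed
    also have "\<dots> \<le> ennreal (1 / C) * (ennreal (measure lebesgue \<Omega>) + ennreal K)"
      using C K(2)[OF u mod] by (subst one_plus[OF u]) (auto intro!: mult_left_mono add_left_mono)
    also have "\<dots> = ennreal ((1 / C) * (measure lebesgue \<Omega> + K))"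
      using C K(1) by (subst ennreal_mult) (auto simp: ennreal_plus)
    also have "\<dots> \<le> 1" using C by (auto simp: C_def)
    finally show ?thesis .
  qed
  \<comment> \<open>The modular of \<open>u\<close> itself is finite because the constant exponent \<open>P\<close> is exactly homogeneous.\<close>
  have "u \<in> nakano_space \<Omega> q" if u: "u \<in> sobolev_space \<Omega> s p" for u
  proof -
    have um: "u \<in> borel_measurable ?M" using u by (simp add: sobolev_space_def nakano_space_def)
    have "sobolev_norm \<Omega> s p u < \<infinity>" using u by (simp add: sobolev_space_def)
    then obtain t where t: "0 < t" "sobolev_modular \<Omega> s p (\<lambda>x. u x / t) < 1"
      unfolding sobolev_norm_def INF_less_iff by blast
    have m: "(\<lambda>x. ennreal (\<bar>u x / t\<bar> powr P)) \<in> borel_measurable ?M" using um by measurable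
    have "nakano_modular \<Omega> (\<lambda>_. P) u = (\<integral>\<^sup>+x. ennreal (t powr P) * ennreal (\<bar>u x / t\<bar> powr P) \<partial>?M)"
      unfolding nakano_modular_def using t
      by (intro nn_integral_cong) (simp add: powr_divide flip: ennreal_mult)
    also have "\<dots> = ennreal (t powr P) * nakano_modular \<Omega> (\<lambda>_. P) (\<lambda>x. u x / t)"
      unfolding nakano_modular_def using m by (rule nn_integral_cmult)
    also have "\<dots> \<le> ennreal (t powr P) * ennreal K"
      using K(2)[OF _ t(2)] um by (intro mult_left_mono) auto
    finally have fin: "nakano_modular \<Omega> (\<lambda>_. P) u < \<infinity>"
      by (simp add: ennreal_mult_less_top le_less_trans)
    have "nakano_modular \<Omega> q u \<le> (\<integral>\<^sup>+x. ennreal (1 * (1 + \<bar>u x\<bar> powr P)) \<partial>?M)"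
      unfolding nakano_modular_def using pw by (intro nn_integral_mono ennreal_leI) auto
    also have "\<dots> < \<infinity>" using fin by (subst one_plus[OF um]) auto
    finally show ?thesis using um by (simp add: nakano_space_def)
  qed
  moreover have "nakano_norm \<Omega> q u \<le> ennreal C * sobolev_norm \<Omega> s p u" if u: "u \<in> sobolev_space \<Omega> s p" for u
  proof -
    have um: "u \<in> borel_measurable ?M" using u by (simp add: sobolev_space_def nakano_space_def)
    have "ennreal (1 / C) * nakano_norm \<Omega> q u \<le> ennreal t"
      if t: "0 < t" "sobolev_modular \<Omega> s p (\<lambda>x. u x / t) < 1" for t
    proof -
      have "nakano_modular \<Omega> q (\<lambda>x. u x / (t * C)) \<le> 1"
        using unit[OF _ t(2)] um by simp
      then have "nakano_norm \<Omega> q u \<le> ennreal (t * C)"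
        unfolding nakano_norm_def using t C by (intro INF_lower) auto
      then have "ennreal (1 / C) * nakano_norm \<Omega> q u \<le> ennreal (1 / C) * ennreal (t * C)"
        by (rule mult_left_mono) simp
      also have "\<dots> = ennreal t" using C t by (simp flip: ennreal_mult)
      finally show ?thesis .
    qed
    then have "ennreal (1 / C) * nakano_norm \<Omega> q u \<le> sobolev_norm \<Omega> s p u"
      unfolding sobolev_norm_def by (intro INF_greatest) auto
    then have "ennreal C * (ennreal (1 / C) * nakano_norm \<Omega> q u) \<le> ennreal C * sobolev_norm \<Omega> s p u"
      by (rule mult_left_mono) simp
    moreover have "ennreal C * ennreal (1 / C) = 1" using C by (simp flip: ennreal_mult)
    ultimately show ?thesis by (simp flip: mult.assoc)
  qed
  ultimately show ?thesis
    unfolding continuous_embedding_def using C by (intro conjI subsetI exI[of _ C]) auto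
qed

theorem theorem2:
  fixes \<Omega> :: "'a::euclidean_space set"
    and p s :: "'a \<times> 'a \<Rightarrow> real"
    and q :: "'a \<Rightarrow> real"
  assumes "bounded_lipschitz_domain \<Omega>"
    and "symmetric_on (closure \<Omega>) p"
    and "symmetric_on (closure \<Omega>) s"
    and "log_holder_on (closure \<Omega> \<times> closure \<Omega>) p"
    and "log_holder_on (closure \<Omega> \<times> closure \<Omega>) s"
    and "0 < (INF z\<in>closure \<Omega> \<times> closure \<Omega>. s z)"
    and "(INF z\<in>closure \<Omega> \<times> closure \<Omega>. s z) \<le> (SUP z\<in>closure \<Omega> \<times> closure \<Omega>. s z)"
    and "(SUP z\<in>closure \<Omega> \<times> closure \<Omega>. s z) < 1"
    and "1 < (INF z\<in>closure \<Omega> \<times> closure \<Omega>. p z)"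
    and "(INF z\<in>closure \<Omega> \<times> closure \<Omega>. p z) \<le> (SUP z\<in>closure \<Omega> \<times> closure \<Omega>. p z)"
    and "(SUP z\<in>closure \<Omega> \<times> closure \<Omega>. p z)
           < real DIM('a) / (SUP z\<in>closure \<Omega> \<times> closure \<Omega>. s z)"
    and "\<And>x. x \<in> closure \<Omega> \<Longrightarrow> local_min_point (closure \<Omega> \<times> closure \<Omega>) s (x, x)"
    and "\<And>x. x \<in> closure \<Omega> \<Longrightarrow> local_min_point (closure \<Omega> \<times> closure \<Omega>) p (x, x)"
    and "continuous_on (closure \<Omega>) q"
    and "(SUP z\<in>closure \<Omega> \<times> closure \<Omega>. p z) \<le> (INF x\<in>closure \<Omega>. q x)"
    and "\<And>x. x \<in> closure \<Omega> \<Longrightarrow> (INF x\<in>closure \<Omega>. q x) \<le> q x \<and> q x \<le> critical_exponent s p x"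
  shows "continuous_embedding (sobolev_space \<Omega> s p) (sobolev_norm \<Omega> s p)
           (nakano_space \<Omega> q) (nakano_norm \<Omega> q)"
proof -
  have om: "open \<Omega>" "connected \<Omega>" "bounded \<Omega>"
    using assms(1) by (auto simp: bounded_lipschitz_domain_def)
  have \<Omega>: "\<Omega> \<in> lmeasurable" using om by (intro lmeasurable_open)
  \<comment> \<open>The empty domain has no point at which to read off \<open>p0\<close> and \<open>s0\<close>.\<close>
  show ?thesis
  proof (cases "\<Omega> = {}")
    case True
    then have "nakano_modular \<Omega> (\<lambda>_. 1) u \<le> ennreal 0" for u
      by (simp add: nakano_modular_def nn_integral_restrict_space)
    then show ?thesis
      using True by (intro continuous_embedding_if_power_bound[OF \<Omega>, of q 1 0]) auto
  next
    case False
    let ?K = "closure \<Omega>"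
    have K: "compact ?K" "connected ?K" "\<And>x. x \<in> \<Omega> \<Longrightarrow> x \<in> ?K"
      using om connected_imp_connected_closure closure_subset by (auto simp: compact_closure)
    obtain a where a: "a \<in> ?K" using False K(3) by blast
    have cont: "continuous_on (?K \<times> ?K) p" "continuous_on (?K \<times> ?K) s"
      using assms(4,5) by (auto simp: log_holder_on_def)
    have bdd: "bdd_below (f ` (?K \<times> ?K)) \<and> bdd_above (f ` (?K \<times> ?K))"
      if "continuous_on (?K \<times> ?K) f" for f :: "'a \<times> 'a \<Rightarrow> real"
      using compact_imp_bounded[OF compact_continuous_image[OF that compact_Times[OF K(1) K(1)]]]
      by (simp add: bounded_imp_bdd_below bounded_imp_bdd_above)
    have bounds:
      "(INF z\<in>?K \<times> ?K. p z) \<le> p z" "p z \<le> (SUP z\<in>?K \<times> ?K. p z)"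
      "(INF z\<in>?K \<times> ?K. s z) \<le> s z" "s z \<le> (SUP z\<in>?K \<times> ?K. s z)" if "z \<in> ?K \<times> ?K" for z
      using bdd[OF cont(1)] bdd[OF cont(2)] that by (auto intro: cINF_lower cSUP_upper)
    define p0 where "p0 = p (a, a)"
    define s0 where "s0 = s (a, a)"
    have diag: "p (x, x) = p0" "s (x, x) = s0" if "x \<in> ?K" for x
      unfolding p0_def s0_def
      using diagonal_local_min_imp_constant[OF K(2) a cont(1) assms(13) that]
        diagonal_local_min_imp_constant[OF K(2) a cont(2) assms(12) that] by auto
    have p0: "1 < p0" "p0 \<le> (SUP z\<in>?K \<times> ?K. p z)"
      using bounds(1,2)[of "(a, a)"] a assms(9) by (auto simp: p0_def)
    have s0: "0 < s0" "s0 \<le> (SUP z\<in>?K \<times> ?K. s z)"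
      using bounds(3,4)[of "(a, a)"] a assms(6) by (auto simp: s0_def)
    have "s0 * p0 \<le> (SUP z\<in>?K \<times> ?K. s z) * (SUP z\<in>?K \<times> ?K. p z)"
      using p0 s0 by (intro mult_mono) auto
    also have "\<dots> < real DIM('a)"
      using assms(11) s0 by (simp add: field_simps)
    finally have sub: "s0 * p0 < real DIM('a)" .
    obtain d1 where d1: "0 < d1" "\<And>x y. x \<in> ?K \<Longrightarrow> y \<in> ?K \<Longrightarrow> dist x y < d1 \<Longrightarrow> p0 \<le> p (x, y)"
      using diagonal_local_min_imp_ge_near_diagonal[OF K(1) assms(13) diag(1)] by blast
    obtain d2 where d2: "0 < d2" "\<And>x y. x \<in> ?K \<Longrightarrow> y \<in> ?K \<Longrightarrow> dist x y < d2 \<Longrightarrow> s0 \<le> s (x, y)"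
      using diagonal_local_min_imp_ge_near_diagonal[OF K(1) assms(12) diag(2)] by blast
    obtain c r0 where c: "0 < c" and r0: "0 < r0"
      and density: "\<And>x r. x \<in> \<Omega> \<Longrightarrow> 0 < r \<Longrightarrow> r \<le> r0 \<Longrightarrow>
        c * r ^ DIM('a) \<le> measure lebesgue (\<Omega> \<inter> ball x r)"
      using lipschitz_domain_measure_density[OF assms(1)] by blast
    define r1 where "r1 = Min {1, r0, d1, d2}"
    have r1: "0 < r1" "r1 \<le> 1" "r1 \<le> r0" "r1 \<le> d1" "r1 \<le> d2"
      using r0 d1 d2 by (auto simp: r1_def)
    let ?P = "real DIM('a) * p0 / (real DIM('a) - p0 * s0)"
    have pos: "0 \<le> p (x, y)" if "x \<in> \<Omega>" "y \<in> \<Omega>" for x y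
      using bounds(1)[of "(x, y)"] assms(9) K(3) that by auto
    have near: "p0 \<le> p (x, y) \<and> s0 \<le> s (x, y)" if "x \<in> \<Omega>" "y \<in> \<Omega>" "dist x y < r1" for x y
      using d1(2)[of x y] d2(2)[of x y] K(3) r1 that by auto
    have density': "c * r ^ DIM('a) \<le> measure lebesgue (\<Omega> \<inter> ball x r)"
      if "x \<in> \<Omega>" "0 < r" "r \<le> r1" for x r
      using density that r1 by simp
    have "0 < p0" using p0 by simp
    obtain C where C: "0 \<le> C"
      "\<And>u. u \<in> borel_measurable (lebesgue_on \<Omega>) \<Longrightarrow> sobolev_modular \<Omega> s p u < 1 \<Longrightarrow>
        nakano_modular \<Omega> (\<lambda>_. ?P) u \<le> ennreal C"
      using critical_power_integral_bound
        [OF \<Omega> \<open>0 < p0\<close> s0(1) sub _ _ c r1(1,2), where p = p and s = s,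
          OF pos diag(1)[OF K(3)] density' near] by blast
    have "1 \<le> q x \<and> q x \<le> ?P" if "x \<in> \<Omega>" for x
      using assms(15) assms(16)[OF K(3)[OF that]] p0 diag[OF K(3)[OF that]]
      by (auto simp: critical_exponent_def)
    then show ?thesis
      using C by (intro continuous_embedding_if_power_bound[OF \<Omega>]) auto
  qed
qed
end
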